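(* Let $p,q>0$. Every nilpotent element $X\in\mathfrak{so}(p,q)$ is strongly $\mathrm{Ad}_{\mathrm{SO}(p,q)}$-real, i.e. there exists $\tau\in\mathrm{SO}(p,q)$ with $\tau^2=\mathrm{Id}$ and $\tau X\tau^{-1}=-X$.
   Context: For a Lie group $G$ with Lie algebra $\mathfrak{g}$, $X\in\mathfrak{g}$ is strongly $\mathrm{Ad}_G$-real if $-X=\mathrm{Ad}(\tau)X$ for some $\tau\in G$ with $\tau^2=\mathrm{Id}$. With $\mathrm{I}_{p,q}=\mathrm{diag}(\mathrm{I}_p,-\mathrm{I}_q)$, $\mathrm{SO}(p,q)=\{g\in\mathrm{SL}_{p+q}(\mathbb{R})\mid g^t\mathrm{I}_{p,q}g=\mathrm{I}_{p,q}\}$ and $\mathfrak{so}(p,q)=\{z\in\mathfrak{sl}_{p+q}(\mathbb{R})\mid z^t\mathrm{I}_{p,q}+\mathrm{I}_{p,q}z=0\}$. *)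

theory Defs
  imports "Jordan_Normal_Form.Determinant"
begin

definition SL_mat :: "nat \<Rightarrow> real mat set" where
  "SL_mat n = {g \<in> carrier_mat n n. det g = 1}"

definition mat_trace :: "real mat \<Rightarrow> real" where
  "mat_trace z = (\<Sum>i<dim_row z. z $$ (i, i))"

definition sl_mat :: "nat \<Rightarrow> real mat set" where
  "sl_mat n = {z \<in> carrier_mat n n. mat_trace z = 0}"

definition I_mat :: "nat \<Rightarrow> nat \<Rightarrow> real mat" where
  "I_mat p q = diag_block_mat [1\<^sub>m p, - 1\<^sub>m q]"

definition SO :: "nat \<Rightarrow> nat \<Rightarrow> real mat monoid" where
  "SO p q = \<lparr>carrier = {g \<in> SL_mat (p + q). g\<^sup>T * I_mat p q * g = I_mat p q},
     mult = (*), one = 1\<^sub>m (p + q)\<rparr>"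

definition so_alg :: "nat \<Rightarrow> nat \<Rightarrow> real mat set" where
  "so_alg p q =
     {z \<in> sl_mat (p + q). z\<^sup>T * I_mat p q + I_mat p q * z = 0\<^sub>m (p + q) (p + q)}"

text \<open>Nilpotency of a matrix, i.e. of the endomorphism of the standard module; this is not
  ad-nilpotency, which every element of the abelian Lie algebra so(1,1) satisfies.\<close>

definition nilpotent_mat :: "real mat \<Rightarrow> bool" where
  "nilpotent_mat X \<longleftrightarrow> (\<exists>k. X ^\<^sub>m k = 0\<^sub>m (dim_row X) (dim_row X))"

text \<open>The adjoint action of a matrix group \<open>G\<close> on its matrix Lie algebra is conjugation; the
  inverse is taken in \<open>G\<close>.\<close>

definition Ad :: "real mat monoid \<Rightarrow> real mat \<Rightarrow> real mat \<Rightarrow> real mat" where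
  "Ad G g X = g * X * inv\<^bsub>G\<^esub> g"

definition strongly_Ad_real :: "real mat monoid \<Rightarrow> real mat \<Rightarrow> bool" where
  "strongly_Ad_real G X \<longleftrightarrow>
     (\<exists>\<tau>\<in>carrier G. \<tau> \<otimes>\<^bsub>G\<^esub> \<tau> = \<one>\<^bsub>G\<^esub> \<and> - X = Ad G \<tau> X)"

lemma I_mat_carrier [simp]: "I_mat p q \<in> carrier_mat (p + q) (p + q)"
  by (rule carrier_matI) (simp_all add: I_mat_def Let_def)

lemma I_mat_index:
  assumes "i < p + q" "j < p + q"
  shows "I_mat p q $$ (i, j) = (if i = j then if i < p then 1 else -1 else 0)"
  using assms unfolding I_mat_def by (auto simp: Let_def)

lemma I_mat_square: "I_mat p q * I_mat p q = 1\<^sub>m (p + q)"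
proof -
  have "I_mat p q = mat_diag (p + q) (\<lambda>i. if i < p then 1 else - 1)"
    by (rule eq_matI) (auto simp: I_mat_index mat_diag_def carrier_matD[OF I_mat_carrier])
  then show ?thesis
    by (simp only: mat_diag_diag) (auto simp: mat_diag_def)
qed

lemma group_SO: "group (SO p q)"
proof (rule groupI)
  let ?n = "p + q" and ?J = "I_mat p q"
  have J: "?J \<in> carrier_mat ?n ?n" by simp
  have closed: "A * B \<in> carrier_mat ?n ?n"
    if "A \<in> carrier_mat ?n ?n" "B \<in> carrier_mat ?n ?n" for A B :: "real mat"
    using that by simp
  show "x \<otimes>\<^bsub>SO p q\<^esub> y \<in> carrier (SO p q)"
    if "x \<in> carrier (SO p q)" "y \<in> carrier (SO p q)" for x y
  proof -
    have x: "x \<in> carrier_mat ?n ?n" "det x = 1" "x\<^sup>T * ?J * x = ?J"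
      and y: "y \<in> carrier_mat ?n ?n" "det y = 1" "y\<^sup>T * ?J * y = ?J"
      using that by (auto simp: SO_def SL_mat_def)
    have "(x * y)\<^sup>T * ?J * (x * y) = y\<^sup>T * (x\<^sup>T * ?J * x) * y"
      using x(1) y(1) J by (simp add: transpose_mult[of _ ?n ?n] assoc_mult_mat[of _ ?n ?n _ ?n _ ?n] closed)
    then show ?thesis using x y by (simp add: SO_def SL_mat_def det_mult[of _ ?n])
  qed
  show "\<one>\<^bsub>SO p q\<^esub> \<in> carrier (SO p q)"
    by (simp add: SO_def SL_mat_def left_mult_one_mat[OF J] right_mult_one_mat[OF J])
  show "x \<otimes>\<^bsub>SO p q\<^esub> y \<otimes>\<^bsub>SO p q\<^esub> z = x \<otimes>\<^bsub>SO p q\<^esub> (y \<otimes>\<^bsub>SO p q\<^esub> z)"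
    if "x \<in> carrier (SO p q)" "y \<in> carrier (SO p q)" "z \<in> carrier (SO p q)" for x y z
    using that by (auto simp: SO_def SL_mat_def)
  show "\<one>\<^bsub>SO p q\<^esub> \<otimes>\<^bsub>SO p q\<^esub> x = x" if "x \<in> carrier (SO p q)" for x
    using that by (auto simp: SO_def SL_mat_def)
  show "\<exists>y\<in>carrier (SO p q). y \<otimes>\<^bsub>SO p q\<^esub> x = \<one>\<^bsub>SO p q\<^esub>"
    if "x \<in> carrier (SO p q)" for x
  proof -
    have x: "x \<in> carrier_mat ?n ?n" "det x = 1" "x\<^sup>T * ?J * x = ?J"
      using that by (auto simp: SO_def SL_mat_def)
    define y where "y = ?J * x\<^sup>T * ?J"
    have y: "y \<in> carrier_mat ?n ?n" unfolding y_def using x(1) by (intro closed) simp_all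
    have "y * x = ?J * (x\<^sup>T * ?J * x)"
      unfolding y_def using x(1) J by (simp add: assoc_mult_mat[of _ ?n ?n _ ?n _ ?n] closed)
    then have yx: "y * x = 1\<^sub>m ?n" using x(3) I_mat_square by simp
    then have xy: "x * y = 1\<^sub>m ?n" using mat_mult_left_right_inverse[OF y x(1)] by simp
    have d: "det y = 1" using det_mult[OF y x(1)] yx x(2) by simp
    have "y\<^sup>T * ?J * y = y\<^sup>T * (x\<^sup>T * ?J * x) * y" using x(3) by simp
    also have "\<dots> = (x * y)\<^sup>T * ?J * (x * y)"
      using x(1) y J by (simp add: transpose_mult[of _ ?n ?n] assoc_mult_mat[of _ ?n ?n _ ?n _ ?n] closed)
    also have "\<dots> = ?J" using xy by (simp add: left_mult_one_mat[OF J] right_mult_one_mat[OF J])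
    finally show ?thesis using y d yx by (auto simp: SO_def SL_mat_def)
  qed
qed

end

theory Submission
  imports Defs
begin

text \<open>Let \<open>B\<close> be the symmetric form for which \<open>X\<close> is skew. On a nonzero nondegenerate \<open>X\<close>-invariant
  subspace let \<open>d\<close> be the nilpotency index of \<open>X\<close>. The form \<open>B v (X^(d-1) w)\<close> is symmetric for odd \<open>d\<close>
  and alternating for even \<open>d\<close>. For odd \<open>d\<close> pick \<open>v\<close> with \<open>B v (X^(d-1) v) \<noteq> 0\<close>: its string
  \<open>v, X v, \<dots>, X^(d-1) v\<close> spans a nondegenerate subspace, on which the involution acts by \<open>\<epsilon> (-1)^i\<close> on
  \<open>X^i v\<close>; the sign \<open>\<epsilon>\<close> makes its determinant \<open>1\<close> because \<open>d\<close> is odd. For even \<open>d\<close> pick \<open>v, w\<close> with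
  \<open>B v (X^k w) \<noteq> 0\<close> only for \<open>k = d - 1\<close>; on the two strings the involution acts by \<open>(-1)^i\<close> and
  \<open>-(-1)^i\<close>, with determinant \<open>(-1)^d = 1\<close>. Then pass to the orthogonal complement.\<close>

section \<open>Matrix preliminaries: inverses, ranks and an antitriangular determinant\<close>

lemma obtain_inverse_mat:
  fixes A :: "'a :: field mat"
  assumes A: "A \<in> carrier_mat n n" and d: "det A \<noteq> 0"
  obtains B where "B \<in> carrier_mat n n" "A * B = 1\<^sub>m n" "B * A = 1\<^sub>m n"
proof -
  define B where "B = inverse (det A) \<cdot>\<^sub>m adj_mat A"
  have B: "B \<in> carrier_mat n n" using adj_mat(1)[OF A] by (simp add: B_def)
  have "A * B = inverse (det A) \<cdot>\<^sub>m (det A \<cdot>\<^sub>m 1\<^sub>m n)"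
    unfolding B_def using adj_mat(1,2)[OF A] A by (simp add: mult_smult_distrib)
  also have "\<dots> = 1\<^sub>m n" using d by (auto)
  finally have AB: "A * B = 1\<^sub>m n" .
  show thesis by (rule that[OF B AB mat_mult_left_right_inverse[OF A B AB]])
qed

text \<open>If \<open>n < k\<close>, zero padding turns both factors into square matrices without
  changing the product. A one-sided inverse of a square matrix is two-sided, which is impossible
  because the padded \<open>A\<close> has a zero row.\<close>

lemma left_inverse_mat_dim_le:
  fixes A C :: "'a :: field mat"
  assumes A: "A \<in> carrier_mat n k" and C: "C \<in> carrier_mat k n" and CA: "C * A = 1\<^sub>m k"
  shows "k \<le> n"
proof (rule ccontr)
  assume "\<not> k \<le> n"
  then have kn: "n < k" by simp
  define A' where "A' = four_block_mat A (0\<^sub>m n 0) (0\<^sub>m (k - n) k) (0\<^sub>m (k - n) 0)"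
  define C' where "C' = four_block_mat C (0\<^sub>m k (k - n)) (0\<^sub>m 0 n) (0\<^sub>m 0 (k - n))"
  have carr: "A' \<in> carrier_mat k k" "C' \<in> carrier_mat k k"
    unfolding A'_def C'_def using A C kn by auto
  have "C' * A' = four_block_mat (C * A) (0\<^sub>m k 0) (0\<^sub>m 0 k) (0\<^sub>m 0 0)"
    unfolding A'_def C'_def
    using A C by (subst mult_four_block_mat[of _ k n _ "k - n" _ 0 _ _ k _ 0]) auto
  also have "\<dots> = 1\<^sub>m k" unfolding CA by (rule eq_matI) auto
  finally have "C' * A' = 1\<^sub>m k" .
  then have "A' * C' = 1\<^sub>m k" by (rule mat_mult_left_right_inverse[OF carr(2,1)])
  then have "(A' * C') $$ (n, n) = 1" using kn by simp
  moreover have "row A' n = 0\<^sub>v k"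
    unfolding A'_def using A kn by (intro eq_vecI) auto
  ultimately show False using carr kn by simp
qed

text \<open>Multiplying by the matrix \<open>R\<close> that reverses the columns makes
  \<open>M\<close> upper triangular and carries its antidiagonal to the diagonal, so
  \<open>det M * det R\<close> is a product of nonzero entries.\<close>

lemma det_antitriangular_nonzero:
  fixes M :: "'a :: field mat"
  assumes M: "M \<in> carrier_mat k k"
    and zero: "\<And>i j. i < k \<Longrightarrow> j < k \<Longrightarrow> k \<le> i + j \<Longrightarrow> M $$ (i, j) = 0"
    and nz: "\<And>i j. i + j + 1 = k \<Longrightarrow> M $$ (i, j) \<noteq> 0"
  shows "det M \<noteq> 0"
proof -
  define R :: "'a mat" where "R = mat k k (\<lambda>(i, j). if i = k - 1 - j then 1 else 0)"
  have R: "R \<in> carrier_mat k k" by (simp add: R_def)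
  have entry: "(M * R) $$ (i, j) = M $$ (i, k - 1 - j)" if "i < k" "j < k" for i j
  proof -
    have "(M * R) $$ (i, j) = (\<Sum>l = 0..<k. M $$ (i, l) * (if l = k - 1 - j then 1 else 0))"
      using that M by (simp add: R_def scalar_prod_def)
    also have "\<dots> = M $$ (i, k - 1 - j)"
      using that by (subst sum.remove[of _ "k - 1 - j"]) auto
    finally show ?thesis .
  qed
  have "upper_triangular (M * R)"
  proof (rule upper_triangularI)
    fix i j assume "j < i" "i < dim_row (M * R)"
    then have "j < i" "i < k" using M by auto
    then show "(M * R) $$ (i, j) = 0" by (subst entry) (auto intro!: zero)
  qed
  then have "det (M * R) = prod_list (diag_mat (M * R))"
    using M R by (intro det_upper_triangular[of _ k]) auto
  also have "\<dots> = (\<Prod>i = 0..<k. (M * R) $$ (i, i))"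
    using M by (simp add: prod_list_diag_prod)
  also have "\<dots> = (\<Prod>i = 0..<k. M $$ (i, k - 1 - i))"
    by (intro prod.cong refl entry) auto
  also have "\<dots> \<noteq> 0" using nz by (simp add: prod_zero_iff)
  finally show ?thesis using det_mult[OF M R] by auto
qed

section \<open>The bilinear form and the powers of the skew endomorphism\<close>

text \<open>The signature is left open: \<open>S\<close> is any nondegenerate symmetric matrix, to
  be instantiated by \<open>I_mat p q\<close>.\<close>

locale skew_nilpotent =
  fixes n :: nat and S X :: "real mat"
  assumes S: "S \<in> carrier_mat n n" and S_sym: "S\<^sup>T = S"
    and S_nondeg: "det S \<noteq> 0"
    and X: "X \<in> carrier_mat n n" and X_skew: "X\<^sup>T * S + S * X = 0\<^sub>m n n"
    and X_nil: "\<exists>k. X ^\<^sub>m k = 0\<^sub>m n n"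
begin

definition B :: "real vec \<Rightarrow> real vec \<Rightarrow> real" where
  "B u v = u \<bullet> (S *\<^sub>v v)"

definition P :: "nat \<Rightarrow> real vec \<Rightarrow> real vec" where
  "P k = ((*\<^sub>v) X ^^ k)"

lemma SX_carrier [simp]:
  "u \<in> carrier_vec n \<Longrightarrow> S *\<^sub>v u \<in> carrier_vec n"
  "u \<in> carrier_vec n \<Longrightarrow> X *\<^sub>v u \<in> carrier_vec n"
  using S X by auto

lemma SX_zero [simp]: "S *\<^sub>v 0\<^sub>v n = 0\<^sub>v n" "X *\<^sub>v 0\<^sub>v n = 0\<^sub>v n"
  using S X by (auto intro!: eq_vecI)

lemma B_zero [simp]: "u \<in> carrier_vec n \<Longrightarrow> B u (0\<^sub>v n) = 0" "v \<in> carrier_vec n \<Longrightarrow> B (0\<^sub>v n) v = 0"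
  using S by (auto simp: B_def)

lemma B_add:
  assumes "u \<in> carrier_vec n" "v \<in> carrier_vec n" "w \<in> carrier_vec n"
  shows "B (u + v) w = B u w + B v w" "B u (v + w) = B u v + B u w"
  using assms S
  by (auto simp: B_def add_scalar_prod_distrib[of _ n] scalar_prod_add_distrib[of _ n]
      mult_add_distrib_mat_vec[of _ n n])

lemma B_smult:
  assumes "u \<in> carrier_vec n" "v \<in> carrier_vec n"
  shows "B (c \<cdot>\<^sub>v u) v = c * B u v" "B u (c \<cdot>\<^sub>v v) = c * B u v"
  using assms S by (auto simp: B_def mult_mat_vec[of _ n n])

lemma B_sym:
  assumes "u \<in> carrier_vec n" "v \<in> carrier_vec n"
  shows "B u v = B v u"
  using transpose_vec_mult_scalar[OF S assms(2,1)] comm_scalar_prod[of "S *\<^sub>v v" n u] assms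
    comm_scalar_prod[of "S *\<^sub>v u" n v]
  unfolding B_def S_sym by simp

lemma B_skew:
  assumes "u \<in> carrier_vec n" "v \<in> carrier_vec n"
  shows "B (X *\<^sub>v u) v = - B u (X *\<^sub>v v)"
proof -
  have "B (X *\<^sub>v u) v = (S *\<^sub>v v) \<bullet> (X *\<^sub>v u)"
    unfolding B_def using assms by (intro comm_scalar_prod[of _ n]) auto
  also have "\<dots> = (X\<^sup>T *\<^sub>v (S *\<^sub>v v)) \<bullet> u"
    using assms by (intro transpose_vec_mult_scalar[OF X, symmetric]) auto
  also have "\<dots> = u \<bullet> (X\<^sup>T *\<^sub>v (S *\<^sub>v v))"
    using assms X by (intro comm_scalar_prod[of _ n]) auto
  finally have 1: "B (X *\<^sub>v u) v = u \<bullet> ((X\<^sup>T * S) *\<^sub>v v)"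
    using assms X S by simp
  have 2: "B u (X *\<^sub>v v) = u \<bullet> ((S * X) *\<^sub>v v)"
    using assms X S by (simp add: B_def)
  have "u \<bullet> ((X\<^sup>T * S + S * X) *\<^sub>v v) = u \<bullet> ((X\<^sup>T * S) *\<^sub>v v) + u \<bullet> ((S * X) *\<^sub>v v)"
    using assms X S
    by (subst add_mult_distrib_mat_vec[of _ n n])
       (auto intro!: scalar_prod_add_distrib[of _ n])
  moreover have "0\<^sub>m n n *\<^sub>v v = 0\<^sub>v n" using assms by (auto intro!: eq_vecI)
  ultimately show ?thesis using 1 2 assms unfolding X_skew by simp
qed

text \<open>The witness is \<open>S *\<^sub>v y\<close>: pairing it with \<open>y\<close> gives its
  Euclidean square norm, which is nonzero because \<open>S\<close> is invertible.\<close>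

lemma B_nondeg:
  assumes y: "y \<in> carrier_vec n" "y \<noteq> 0\<^sub>v n"
  obtains z where "z \<in> carrier_vec n" "B y z \<noteq> 0"
proof -
  have "S *\<^sub>v y \<noteq> 0\<^sub>v n"
    using det_0_iff_vec_prod_zero_field[OF S] S_nondeg y by blast
  moreover have "B y (S *\<^sub>v y) = (S *\<^sub>v y) \<bullet> (S *\<^sub>v y)"
    using B_sym[of y "S *\<^sub>v y"] y by (simp add: B_def)
  moreover have "v = 0\<^sub>v n" if "v \<bullet> v = 0" "v \<in> carrier_vec n" for v :: "real vec"
    using that by (intro eq_vecI) (auto simp: scalar_prod_def sum_nonneg_eq_0_iff)
  ultimately have "B y (S *\<^sub>v y) \<noteq> 0"
    using y by auto
  with y show thesis by (intro that[of "S *\<^sub>v y"]) auto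
qed

lemma P_0 [simp]: "P 0 u = u" by (simp add: P_def)

lemma P_Suc: "P (Suc k) u = X *\<^sub>v P k u" by (simp add: P_def)

lemma P_add: "P (i + j) u = P i (P j u)" by (simp add: P_def funpow_add)

lemma P_carrier [simp]: "u \<in> carrier_vec n \<Longrightarrow> P k u \<in> carrier_vec n"
  by (induction k) (auto simp: P_Suc)

lemma P_zero [simp]: "P k (0\<^sub>v n) = 0\<^sub>v n"
  using X by (induction k) (auto simp: P_Suc)

lemma P_plus:
  "u \<in> carrier_vec n \<Longrightarrow> v \<in> carrier_vec n \<Longrightarrow> P k (u + v) = P k u + P k v"
  by (induction k) (simp_all add: P_Suc mult_add_distrib_mat_vec[OF X])

lemma P_smult: "u \<in> carrier_vec n \<Longrightarrow> P k (c \<cdot>\<^sub>v u) = c \<cdot>\<^sub>v P k u"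
  using X by (induction k) (auto simp: P_Suc mult_mat_vec[of _ n n])

lemma P_nilpotent: "\<exists>k. \<forall>u\<in>carrier_vec n. P k u = 0\<^sub>v n"
proof -
  obtain k where k: "X ^\<^sub>m k = 0\<^sub>m n n" using X_nil by blast
  have pc: "X ^\<^sub>m i \<in> carrier_mat n n" for i using X by simp
  have "P i u = X ^\<^sub>m i *\<^sub>v u" if "u \<in> carrier_vec n" for u i
    using that
  proof (induction i arbitrary: u)
    case 0
    then show ?case using X by simp
  next
    case (Suc i)
    have "P (Suc i) u = P i (X *\<^sub>v u)" using P_add[of i 1 u] by (simp add: P_Suc)
    also have "\<dots> = X ^\<^sub>m Suc i *\<^sub>v u"
      using Suc X assoc_mult_mat_vec[OF pc X, of u i] by simp
    finally show ?case .
  qed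
  then show ?thesis using k by (intro exI[of _ k]) auto
qed

lemma B_P_left:
  assumes "u \<in> carrier_vec n" "v \<in> carrier_vec n"
  shows "B (P k u) v = (- 1) ^ k * B u (P k v)"
  using assms
proof (induction k arbitrary: v)
  case (Suc k)
  have "B (P (Suc k) u) v = - B (P k u) (X *\<^sub>v v)" using Suc by (simp add: P_Suc B_skew)
  also have "\<dots> = - ((- 1) ^ k * B u (P k (X *\<^sub>v v)))" using Suc by simp
  also have "P k (X *\<^sub>v v) = P (Suc k) v" using P_add[of k 1 v] by (simp add: P_Suc)
  finally show ?case by simp
qed simp

text \<open>This is the source of the parity distinction: for \<open>u = v\<close> and odd
  \<open>k\<close> it forces \<open>B v (P k v) = 0\<close>.\<close>

lemma B_P_swap:
  assumes "u \<in> carrier_vec n" "v \<in> carrier_vec n"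
  shows "B v (P k u) = (- 1) ^ k * B u (P k v)"
  using B_P_left[OF assms, of k] B_sym[of "P k u" v] assms by simp

section \<open>Frames: eigenvector systems of the future involution\<close>

text \<open>A vector paired with a sign records an eigenvector of the involution under construction.\<close>

definition gram :: "(real vec \<times> real) list \<Rightarrow> real mat" where
  "gram fs = mat (length fs) (length fs) (\<lambda>(i, j). B (fst (fs ! i)) (fst (fs ! j)))"

text \<open>Each clause serves one property of the involution \<open>T\<close> that scales each
  vector by its sign. The flip from \<open>s\<close> to \<open>- s\<close> under \<open>X\<close>
  makes \<open>T\<close> anticommute with \<open>X\<close>, and \<open>s * s = 1\<close> makes it an
  involution. Orthogonality between opposite signs makes it an isometry, and the product of the
  signs is its determinant. The Gram determinant gives linear independence and a nondegenerate
  span.\<close>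

definition frame :: "(real vec \<times> real) list \<Rightarrow> bool" where
  "frame fs \<longleftrightarrow>
     (\<forall>(u, s)\<in>set fs. u \<in> carrier_vec n \<and> s * s = 1 \<and> (X *\<^sub>v u = 0\<^sub>v n \<or> (X *\<^sub>v u, - s) \<in> set fs)) \<and>
     (\<forall>(u, s)\<in>set fs. \<forall>(v, t)\<in>set fs. B u v \<noteq> 0 \<longrightarrow> s = t) \<and>
     det (gram fs) \<noteq> 0 \<and> prod_list (map snd fs) = 1"

definition perp :: "(real vec \<times> real) list \<Rightarrow> real vec set" where
  "perp fs = {y \<in> carrier_vec n. \<forall>(u, s)\<in>set fs. B u y = 0}"

lemma frameD:
  assumes "frame fs" "(u, s) \<in> set fs"
  shows "u \<in> carrier_vec n" "s * s = 1" "X *\<^sub>v u = 0\<^sub>v n \<or> (X *\<^sub>v u, - s) \<in> set fs"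
    and "(v, t) \<in> set fs \<Longrightarrow> B u v \<noteq> 0 \<Longrightarrow> s = t"
  using assms bspec[of "set fs" _ "(u, s)"] bspec[of "set fs" _ "(v, t)"] by (auto simp: frame_def)

lemma frameI:
  assumes "\<And>u s. (u, s) \<in> set fs \<Longrightarrow> u \<in> carrier_vec n \<and> s * s = 1 \<and> (X *\<^sub>v u = 0\<^sub>v n \<or> (X *\<^sub>v u, - s) \<in> set fs)"
    and "\<And>u s v t. (u, s) \<in> set fs \<Longrightarrow> (v, t) \<in> set fs \<Longrightarrow> B u v \<noteq> 0 \<Longrightarrow> s = t"
    and "det (gram fs) \<noteq> 0" "prod_list (map snd fs) = 1"
  shows "frame fs"
  unfolding frame_def
proof (intro conjI ballI)
  show "case x of (u, s) \<Rightarrow> u \<in> carrier_vec n \<and> s * s = 1 \<and> (X *\<^sub>v u = 0\<^sub>v n \<or> (X *\<^sub>v u, - s) \<in> set fs)"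
    if "x \<in> set fs" for x using assms(1) that by (cases x) simp
  show "case x of (u, s) \<Rightarrow> \<forall>(v, t)\<in>set fs. B u v \<noteq> 0 \<longrightarrow> s = t" if "x \<in> set fs" for x
    using assms(2) that by (cases x) auto
qed (use assms in auto)

lemma perpD:
  assumes "y \<in> perp fs"
  shows "y \<in> carrier_vec n" "(u, s) \<in> set fs \<Longrightarrow> B u y = 0"
  using assms bspec[of "set fs" _ "(u, s)"] by (auto simp: perp_def)

lemma perpI:
  assumes "y \<in> carrier_vec n" "\<And>u s. (u, s) \<in> set fs \<Longrightarrow> B u y = 0"
  shows "y \<in> perp fs"
  using assms by (auto simp: perp_def)

lemma frame_Nil: "frame []"
  by (simp add: frame_def gram_def)

lemma gram_carrier [simp]: "gram fs \<in> carrier_mat (length fs) (length fs)"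
  by (simp add: gram_def)

text \<open>Orthogonality makes the Gram matrix block diagonal, so its determinant is a product of
  nonzero factors. The sign products multiply, and no new nonzero pairing arises between the two
  lists.\<close>

lemma frame_append:
  assumes fs: "frame fs" and gs: "frame gs" and orth: "\<And>g s. (g, s) \<in> set gs \<Longrightarrow> g \<in> perp fs"
  shows "frame (fs @ gs)"
proof -
  have o1: "B u v = 0" if "(u, s) \<in> set fs" "(v, t) \<in> set gs" for u v s t
    using perpD(2)[OF orth[OF that(2)] that(1)] .
  have o2: "B v u = 0" if "(u, s) \<in> set fs" "(v, t) \<in> set gs" for u v s t
    using o1[OF that] B_sym[of u v] fs gs that by (auto simp: frame_def)
  have "gram (fs @ gs) =
    four_block_mat (gram fs) (0\<^sub>m (length fs) (length gs)) (0\<^sub>m (length gs) (length fs)) (gram gs)"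
    (is "_ = ?R")
  proof (rule eq_matI)
    fix i j assume "i < dim_row ?R" "j < dim_col ?R"
    then have ij: "i < length fs + length gs" "j < length fs + length gs" by (auto simp: gram_def)
    have f: "(fst (fs ! i), snd (fs ! i)) \<in> set fs" if "i < length fs" for i using that by simp
    have g: "(fst (gs ! (i - length fs)), snd (gs ! (i - length fs))) \<in> set gs"
      if "\<not> i < length fs" "i < length fs + length gs" for i using that by simp
    show "gram (fs @ gs) $$ (i, j) = ?R $$ (i, j)"
      using ij o1[OF f g] o2[OF f g] by (auto simp: gram_def nth_append)
  qed (auto simp: gram_def)
  then have "det (gram (fs @ gs)) = det (gram fs) * det (gram gs)"
    by (simp add: det_four_block_mat_upper_right_zero[of _ "length fs" _ "length gs"])
  then have "det (gram (fs @ gs)) \<noteq> 0" "prod_list (map snd (fs @ gs)) = 1"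
    using fs gs by (auto simp: frame_def)
  moreover have "s = t" if "(u, s) \<in> set (fs @ gs)" "(v, t) \<in> set (fs @ gs)" "B u v \<noteq> 0" for u v s t
    using that frameD(4)[OF fs, of u s v t] frameD(4)[OF gs, of u s v t] o1[of u s v t] o2[of v t u s]
    by (metis Un_iff set_append)
  moreover have "u \<in> carrier_vec n \<and> s * s = 1 \<and> (X *\<^sub>v u = 0\<^sub>v n \<or> (X *\<^sub>v u, - s) \<in> set (fs @ gs))"
    if "(u, s) \<in> set (fs @ gs)" for u s
    using that frameD(1-3)[OF fs, of u s] frameD(1-3)[OF gs, of u s] by auto
  ultimately show ?thesis by (intro frameI)
qed

section \<open>The matrix of a frame and the orthogonal projection onto its span\<close>

definition fmat :: "(real vec \<times> real) list \<Rightarrow> real mat" where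
  "fmat fs = mat_of_cols n (map fst fs)"

lemma fmat_carrier [simp]: "fmat fs \<in> carrier_mat n (length fs)"
  using mat_of_cols_carrier(1)[of n "map fst fs"] by (simp add: fmat_def)

lemma frame_carrier: "frame fs \<Longrightarrow> i < length fs \<Longrightarrow> fst (fs ! i) \<in> carrier_vec n"
  using frameD(1)[of fs "fst (fs ! i)" "snd (fs ! i)"] by simp

lemma col_fmat: "frame fs \<Longrightarrow> i < length fs \<Longrightarrow> col (fmat fs) i = fst (fs ! i)"
  by (simp add: fmat_def frame_carrier)

lemma fmat_transpose_mult:
  assumes "frame fs" "y \<in> carrier_vec n"
  shows "(fmat fs)\<^sup>T *\<^sub>v (S *\<^sub>v y) = vec (length fs) (\<lambda>i. B (fst (fs ! i)) y)"
  using assms fmat_carrier[of fs]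
  by (intro eq_vecI) (auto simp: B_def col_fmat carrier_matD[OF fmat_carrier])

lemma gram_eq:
  assumes "frame fs"
  shows "(fmat fs)\<^sup>T * (S * fmat fs) = gram fs"
proof (rule eq_matI)
  fix i j assume "i < dim_row (gram fs)" "j < dim_col (gram fs)"
  then have ij: "i < length fs" "j < length fs" by (auto simp: gram_def)
  have "col (S * fmat fs) j = S *\<^sub>v fst (fs ! j)"
    using ij col_mult2[OF S fmat_carrier[of fs], of j] col_fmat[OF assms, of j] by simp
  then show "((fmat fs)\<^sup>T * (S * fmat fs)) $$ (i, j) = gram fs $$ (i, j)"
    using ij assms S by (simp add: gram_def B_def col_fmat carrier_matD[OF fmat_carrier])
qed (auto simp: gram_def carrier_matD[OF fmat_carrier])

lemma B_fmat_mult: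
  assumes fs: "frame fs" and c: "c \<in> carrier_vec (length fs)" and z: "z \<in> carrier_vec n"
  shows "B z (fmat fs *\<^sub>v c) = ((fmat fs)\<^sup>T *\<^sub>v (S *\<^sub>v z)) \<bullet> c"
proof -
  have Ac: "fmat fs *\<^sub>v c \<in> carrier_vec n" using mult_mat_vec_carrier[OF fmat_carrier c] .
  have "B z (fmat fs *\<^sub>v c) = B (fmat fs *\<^sub>v c) z" using B_sym Ac z by simp
  also have "\<dots> = (S *\<^sub>v z) \<bullet> (fmat fs *\<^sub>v c)"
    unfolding B_def using Ac z by (intro comm_scalar_prod[of _ n]) auto
  also have "\<dots> = ((fmat fs)\<^sup>T *\<^sub>v (S *\<^sub>v z)) \<bullet> c"
    using transpose_vec_mult_scalar[OF fmat_carrier c, of "S *\<^sub>v z"] z by simp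
  finally show ?thesis .
qed

text \<open>Here \<open>u\<close> is the orthogonal projection of \<open>y\<close> onto the span of
  the frame: its coefficients come from solving the Gram system, whose right-hand side lists the
  pairings of \<open>y\<close> with the frame vectors.\<close>

lemma frame_projection:
  assumes fs: "frame fs" and H: "H \<in> carrier_mat (length fs) (length fs)"
    and GH: "gram fs * H = 1\<^sub>m (length fs)" and y: "y \<in> carrier_vec n"
  defines "u \<equiv> fmat fs *\<^sub>v (H *\<^sub>v ((fmat fs)\<^sup>T *\<^sub>v (S *\<^sub>v y)))"
  shows "u \<in> carrier_vec n" and "y - u \<in> perp fs" and "z \<in> perp fs \<Longrightarrow> B z u = 0"
proof -
  let ?k = "length fs" and ?A = "fmat fs"
  define b where "b = ?A\<^sup>T *\<^sub>v (S *\<^sub>v y)"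
  have At: "?A\<^sup>T \<in> carrier_mat ?k n" using fmat_carrier by simp
  have b: "b \<in> carrier_vec ?k" unfolding b_def using mult_mat_vec_carrier[OF At] y by simp
  have Hb: "H *\<^sub>v b \<in> carrier_vec ?k" using mult_mat_vec_carrier[OF H b] .
  have u_def': "u = ?A *\<^sub>v (H *\<^sub>v b)" by (simp add: u_def b_def)
  show u: "u \<in> carrier_vec n" unfolding u_def' using mult_mat_vec_carrier[OF fmat_carrier Hb] .
  have SA: "S * ?A \<in> carrier_mat n ?k" using mult_carrier_mat[OF S fmat_carrier] .
  have "?A\<^sup>T *\<^sub>v (S *\<^sub>v u) = ?A\<^sup>T *\<^sub>v ((S * ?A) *\<^sub>v (H *\<^sub>v b))"
    unfolding u_def' using assoc_mult_mat_vec[OF S fmat_carrier Hb] by simp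
  also have "\<dots> = (?A\<^sup>T * (S * ?A)) *\<^sub>v (H *\<^sub>v b)"
    using assoc_mult_mat_vec[OF At SA Hb] by simp
  also have "\<dots> = (gram fs * H) *\<^sub>v b"
    unfolding gram_eq[OF fs] using assoc_mult_mat_vec[OF gram_carrier H b] by simp
  also have "\<dots> = b" unfolding GH using b by simp
  finally have eq: "?A\<^sup>T *\<^sub>v (S *\<^sub>v u) = ?A\<^sup>T *\<^sub>v (S *\<^sub>v y)" unfolding b_def .
  have "B v (y - u) = 0" if "(v, s) \<in> set fs" for v s
  proof -
    from that obtain i where i: "i < ?k" "fs ! i = (v, s)" unfolding in_set_conv_nth by auto
    have v: "v \<in> carrier_vec n" using frameD(1)[OF fs that] .
    have "B v u = B v y"
      using arg_cong[OF eq[unfolded fmat_transpose_mult[OF fs u] fmat_transpose_mult[OF fs y]],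
          of "\<lambda>w. w $ i"] i by simp
    moreover have "y - u = y + (- 1) \<cdot>\<^sub>v u" using y u by (intro eq_vecI) auto
    ultimately show ?thesis using v u y by (simp add: B_add B_smult)
  qed
  then show "y - u \<in> perp fs" using y u by (intro perpI) auto
  show "B z u = 0" if z: "z \<in> perp fs"
  proof -
    have zc: "z \<in> carrier_vec n" using perpD(1)[OF z] .
    have "?A\<^sup>T *\<^sub>v (S *\<^sub>v z) = 0\<^sub>v ?k"
      unfolding fmat_transpose_mult[OF fs zc]
    proof (rule eq_vecI)
      fix i assume "i < dim_vec (0\<^sub>v ?k :: real vec)"
      then have i: "i < ?k" by simp
      then have "(fst (fs ! i), snd (fs ! i)) \<in> set fs" by simp
      then have "B (fst (fs ! i)) z = 0" by (rule perpD(2)[OF z])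
      then show "vec ?k (\<lambda>i. B (fst (fs ! i)) z) $ i = 0\<^sub>v ?k $ i" using i by simp
    qed simp
    then show ?thesis unfolding u_def' B_fmat_mult[OF fs Hb zc] using Hb by simp
  qed
qed

lemma frame_inverse:
  assumes "frame fs"
  obtains H where "H \<in> carrier_mat (length fs) (length fs)" "gram fs * H = 1\<^sub>m (length fs)"
    "H * gram fs = 1\<^sub>m (length fs)"
proof -
  have "det (gram fs) \<noteq> 0" using assms by (simp add: frame_def)
  then show thesis using obtain_inverse_mat[OF gram_carrier] that by metis
qed

text \<open>The inverse of the Gram matrix yields a left inverse of \<open>fmat fs\<close>, which
  expresses that the frame vectors are linearly independent.\<close>

lemma frame_left_inverse:
  assumes fs: "frame fs" and H: "H \<in> carrier_mat (length fs) (length fs)"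
    and HG: "H * gram fs = 1\<^sub>m (length fs)"
  shows "H * ((fmat fs)\<^sup>T * S) \<in> carrier_mat (length fs) n"
    and "(H * ((fmat fs)\<^sup>T * S)) * fmat fs = 1\<^sub>m (length fs)"
proof -
  have At: "(fmat fs)\<^sup>T \<in> carrier_mat (length fs) n" using fmat_carrier by simp
  have AS: "(fmat fs)\<^sup>T * S \<in> carrier_mat (length fs) n" using mult_carrier_mat[OF At S] .
  show "H * ((fmat fs)\<^sup>T * S) \<in> carrier_mat (length fs) n" using mult_carrier_mat[OF H AS] .
  have "(H * ((fmat fs)\<^sup>T * S)) * fmat fs = H * ((fmat fs)\<^sup>T * (S * fmat fs))"
    using assoc_mult_mat[OF H AS fmat_carrier] assoc_mult_mat[OF At S fmat_carrier] by simp
  then show "(H * ((fmat fs)\<^sup>T * S)) * fmat fs = 1\<^sub>m (length fs)" using gram_eq[OF fs] HG by simp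
qed

lemma frame_length:
  assumes "frame fs"
  shows "length fs \<le> n"
proof -
  obtain H where "H \<in> carrier_mat (length fs) (length fs)" "H * gram fs = 1\<^sub>m (length fs)"
    using frame_inverse[OF assms] .
  from frame_left_inverse[OF assms this] left_inverse_mat_dim_le[OF fmat_carrier]
  show ?thesis by blast
qed

text \<open>A partner \<open>z\<close> of \<open>y\<close> exists in the whole space. Subtracting
  its projection onto the span moves it into the complement without changing its pairing with
  \<open>y\<close>, since \<open>y\<close> is orthogonal to the span.\<close>

lemma perp_nondeg:
  assumes fs: "frame fs" and y: "y \<in> perp fs" "y \<noteq> 0\<^sub>v n"
  obtains z where "z \<in> perp fs" "B y z \<noteq> 0"
proof -
  have yc: "y \<in> carrier_vec n" using perpD(1)[OF y(1)] .
  obtain z where z: "z \<in> carrier_vec n" "B y z \<noteq> 0" using B_nondeg[OF yc y(2)] .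
  obtain H where H: "H \<in> carrier_mat (length fs) (length fs)" "gram fs * H = 1\<^sub>m (length fs)"
    using frame_inverse[OF fs] .
  define u where "u = fmat fs *\<^sub>v (H *\<^sub>v ((fmat fs)\<^sup>T *\<^sub>v (S *\<^sub>v z)))"
  note p = frame_projection[OF fs H z(1), folded u_def]
  have "z - u = z + (- 1) \<cdot>\<^sub>v u" using z p(1) by (intro eq_vecI) auto
  then have "B y (z - u) = B y z" using yc z p(1) p(3)[OF y(1)] by (simp add: B_add B_smult)
  with z p(2) show thesis by (intro that[of "z - u"]) auto
qed

section \<open>A frame with trivial complement yields the involution\<close>

text \<open>With trivial complement the frame is a basis, and \<open>T\<close> is the diagonal
  matrix of signs conjugated by the matrix of frame vectors. Every required identity is then checked
  on frame vectors.\<close>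

lemma frame_complete:
  assumes fs: "frame fs" and triv: "perp fs \<subseteq> {0\<^sub>v n}"
  shows "\<exists>T\<in>carrier_mat n n. T * T = 1\<^sub>m n \<and> T * X = - (X * T) \<and> T\<^sup>T * S * T = S \<and> det T = 1"
proof -
  let ?A = "fmat fs"
  obtain H where H: "H \<in> carrier_mat (length fs) (length fs)" "gram fs * H = 1\<^sub>m (length fs)"
    "H * gram fs = 1\<^sub>m (length fs)"
    using frame_inverse[OF fs] .
  define C where "C = H * (?A\<^sup>T * S)"
  note li = frame_left_inverse[OF fs H(1,3), folded C_def]
  have At: "?A\<^sup>T \<in> carrier_mat (length fs) n" using fmat_carrier by simp
  have AS: "?A\<^sup>T * S \<in> carrier_mat (length fs) n" using mult_carrier_mat[OF At S] .
  \<comment> \<open>\<open>?A * C\<close> is the orthogonal projection onto the span, and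
    \<open>y\<close> minus its projection lies in the trivial complement.\<close>
  have fixed: "(?A * C) *\<^sub>v y = y" if y: "y \<in> carrier_vec n" for y
  proof -
    define u where "u = ?A *\<^sub>v (H *\<^sub>v (?A\<^sup>T *\<^sub>v (S *\<^sub>v y)))"
    note p = frame_projection[OF fs H(1,2) y, folded u_def]
    have "(?A * C) *\<^sub>v y = ?A *\<^sub>v (C *\<^sub>v y)" using assoc_mult_mat_vec[OF fmat_carrier li(1) y] .
    also have "C *\<^sub>v y = H *\<^sub>v (?A\<^sup>T *\<^sub>v (S *\<^sub>v y))"
      unfolding C_def using assoc_mult_mat_vec[OF H(1) AS y] assoc_mult_mat_vec[OF At S y] by simp
    finally have "(?A * C) *\<^sub>v y = u" by (simp add: u_def)
    moreover have "y - u = 0\<^sub>v n" using p(2) triv by blast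
    then have "(y - u) $ i = 0" if "i < n" for i using that by simp
    then have "y = u" using y p(1) by (intro eq_vecI) auto
    ultimately show ?thesis by simp
  qed
  have AC_carrier: "?A * C \<in> carrier_mat n n" using mult_carrier_mat[OF fmat_carrier li(1)] .
  have AC: "?A * C = 1\<^sub>m n"
  proof (rule mat_col_eqI)
    fix i assume "i < dim_col (1\<^sub>m n :: real mat)"
    then have "col ((?A * C) * 1\<^sub>m n) i = col (1\<^sub>m n) i"
      using col_mult2[OF AC_carrier one_carrier_mat, of i] fixed by simp
    then show "col (?A * C) i = col (1\<^sub>m n) i"
      using right_mult_one_mat[OF AC_carrier] by simp
  qed (use AC_carrier in auto)
  \<comment> \<open>The identities \<open>C * ?A = 1\<close> and \<open>?A * C = 1\<close> bound the
    length from above and from below.\<close>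
  have len: "length fs = n"
    using frame_length[OF fs] left_inverse_mat_dim_le[OF li(1) fmat_carrier AC] by simp
  have A: "?A \<in> carrier_mat n n" using fmat_carrier[of fs] len by simp
  have C: "C \<in> carrier_mat n n" using li(1) len by simp
  have CA: "C * ?A = 1\<^sub>m n" using li(2) len by simp
  define D where "D = mat_diag n (\<lambda>i. snd (fs ! i))"
  have D: "D \<in> carrier_mat n n" by (simp add: D_def)
  have sq: "snd (fs ! i) * snd (fs ! i) = 1" if "i < n" for i
    using frameD(2)[OF fs, of "fst (fs ! i)" "snd (fs ! i)"] that len by simp
  have DD: "D * D = 1\<^sub>m n"
    unfolding D_def mat_diag_diag using sq by (intro eq_matI) (auto simp: mat_diag_def)
  define T where "T = ?A * (D * C)"
  have DC: "D * C \<in> carrier_mat n n" using D C by simp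
  have T: "T \<in> carrier_mat n n" unfolding T_def using A DC by simp
  have TA: "T * ?A = ?A * D"
  proof -
    have "T * ?A = ?A * (D * (C * ?A))"
      unfolding T_def using assoc_mult_mat[OF A DC A] assoc_mult_mat[OF D C A] by simp
    then show ?thesis using CA D by simp
  qed
  have cancel: "M = M'" if "M * ?A = M' * ?A" "M \<in> carrier_mat n n" "M' \<in> carrier_mat n n" for M M'
  proof -
    have "M * (?A * C) = M' * (?A * C)"
      using that(1) assoc_mult_mat[OF that(2) A C] assoc_mult_mat[OF that(3) A C] by simp
    then show ?thesis using AC that by simp
  qed
  have Tu: "T *\<^sub>v u = s \<cdot>\<^sub>v u" if "(u, s) \<in> set fs" for u s
  proof -
    from that len obtain i where i: "i < n" "fs ! i = (u, s)" unfolding in_set_conv_nth by auto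
    have "T *\<^sub>v col ?A i = col (?A * D) i" using col_mult2[OF T A i(1)] TA by simp
    also have "\<dots> = s \<cdot>\<^sub>v col ?A i"
      unfolding D_def mat_diag_mult_right[OF A] using i A by (intro eq_vecI) (auto simp: mult.commute)
    finally show ?thesis using col_fmat[OF fs, of i] i len by simp
  qed
  have by_cols: "M = M'" if M: "M \<in> carrier_mat n n" "M' \<in> carrier_mat n n"
    and eq: "\<And>u s. (u, s) \<in> set fs \<Longrightarrow> M *\<^sub>v u = M' *\<^sub>v u" for M M'
  proof (rule cancel[OF _ M], rule mat_col_eqI)
    fix i assume "i < dim_col (M' * ?A)"
    then have i: "i < n" using A by simp
    then have "(col ?A i, snd (fs ! i)) \<in> set fs" using col_fmat[OF fs, of i] len by simp
    then show "col (M * ?A) i = col (M' * ?A) i"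
      using eq col_mult2[OF M(1) A i] col_mult2[OF M(2) A i] by simp
  qed (use M A in auto)
  have "T * T = 1\<^sub>m n"
  proof (rule by_cols)
    fix u s assume us: "(u, s) \<in> set fs"
    have u: "u \<in> carrier_vec n" and s: "s * s = 1" using frameD(1,2)[OF fs us] .
    have "(T * T) *\<^sub>v u = T *\<^sub>v (s \<cdot>\<^sub>v u)" using assoc_mult_mat_vec[OF T T u] Tu[OF us] by simp
    also have "\<dots> = u" using mult_mat_vec[OF T u] Tu[OF us] s by (simp add: smult_smult_assoc)
    finally show "(T * T) *\<^sub>v u = 1\<^sub>m n *\<^sub>v u" using u by simp
  qed (use T in auto)
  moreover have "T * X = - (X * T)"
  proof (rule by_cols)
    fix u s assume us: "(u, s) \<in> set fs"
    have u: "u \<in> carrier_vec n" using frameD(1)[OF fs us] .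
    have "T *\<^sub>v (X *\<^sub>v u) = (- s) \<cdot>\<^sub>v (X *\<^sub>v u)"
      using frameD(3)[OF fs us]
    proof
      assume "X *\<^sub>v u = 0\<^sub>v n"
      moreover have "T *\<^sub>v 0\<^sub>v n = 0\<^sub>v n" using T by (auto intro!: eq_vecI)
      ultimately show ?thesis by (auto intro!: eq_vecI)
    qed (rule Tu)
    then have "(T * X) *\<^sub>v u = (- s) \<cdot>\<^sub>v (X *\<^sub>v u)" using assoc_mult_mat_vec[OF T X u] by simp
    also have "\<dots> = - ((X * T) *\<^sub>v u)"
      using assoc_mult_mat_vec[OF X T u] Tu[OF us] mult_mat_vec[OF X u] X u
      by (intro eq_vecI) auto
    also have "\<dots> = - (X * T) *\<^sub>v u" using X T u by (subst uminus_mult_mat_vec) auto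
    finally show "(T * X) *\<^sub>v u = - (X * T) *\<^sub>v u" .
  qed (use T X in auto)
  moreover have "T\<^sup>T * S * T = S"
  proof (rule by_cols)
    have Tt: "T\<^sup>T \<in> carrier_mat n n" using T by simp
    have TtS: "T\<^sup>T * S \<in> carrier_mat n n" using Tt S by simp
    show "T\<^sup>T * S * T \<in> carrier_mat n n" using TtS T by simp
    show "S \<in> carrier_mat n n" by (rule S)
    fix u s assume us: "(u, s) \<in> set fs"
    have u: "u \<in> carrier_vec n" using frameD(1)[OF fs us] .
    let ?w = "(T\<^sup>T * S * T) *\<^sub>v u"
    have w_eq: "?w = T\<^sup>T *\<^sub>v (S *\<^sub>v (T *\<^sub>v u))"
      using assoc_mult_mat_vec[OF TtS T u] assoc_mult_mat_vec[OF Tt S, of "T *\<^sub>v u"] T u by simp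
    have w: "?w \<in> carrier_vec n" unfolding w_eq using T S u by simp
    have "?A\<^sup>T *\<^sub>v ?w = ?A\<^sup>T *\<^sub>v (S *\<^sub>v u)"
    proof (rule eq_vecI)
      fix i assume "i < dim_vec (?A\<^sup>T *\<^sub>v (S *\<^sub>v u))"
      then have i: "i < n" using A by simp
      define v t where "v = fst (fs ! i)" and "t = snd (fs ! i)"
      have vt: "(v, t) \<in> set fs" unfolding v_def t_def using i len by simp
      have v: "v \<in> carrier_vec n" using frameD(1)[OF fs vt] .
      have TTu: "T *\<^sub>v u \<in> carrier_vec n" using T u by simp
      have "v \<bullet> ?w = ?w \<bullet> v" using comm_scalar_prod[OF v w] .
      also have "\<dots> = (S *\<^sub>v (T *\<^sub>v u)) \<bullet> (T *\<^sub>v v)"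
        unfolding w_eq using transpose_vec_mult_scalar[OF T v] TTu by simp
      also have "\<dots> = B (T *\<^sub>v v) (T *\<^sub>v u)"
        unfolding B_def using T v TTu by (intro comm_scalar_prod[of _ n]) auto
      also have "\<dots> = t * (s * B v u)"
        unfolding Tu[OF us] Tu[OF vt] using u v by (simp add: B_smult)
      \<comment> \<open>If the pairing is nonzero, the two signs agree and their product is
        \<open>1\<close>; otherwise both sides vanish.\<close>
      also have "\<dots> = B v u"
        using frameD(4)[OF fs us vt] B_sym[OF u v] frameD(2)[OF fs us]
        by (cases "B v u = 0") auto
      finally have "v \<bullet> ?w = v \<bullet> (S *\<^sub>v u)" unfolding B_def .
      then show "(?A\<^sup>T *\<^sub>v ?w) $ i = (?A\<^sup>T *\<^sub>v (S *\<^sub>v u)) $ i"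
        using i A len col_fmat[OF fs, of i] by (simp add: v_def)
    qed (use A in auto)
    \<comment> \<open>The two vectors have equal pairings with all frame vectors; as
      \<open>C\<^sup>T\<close> inverts \<open>?A\<^sup>T\<close>, they are equal.\<close>
    then have "C\<^sup>T *\<^sub>v (?A\<^sup>T *\<^sub>v ?w) = C\<^sup>T *\<^sub>v (?A\<^sup>T *\<^sub>v (S *\<^sub>v u))" by simp
    moreover have "C\<^sup>T *\<^sub>v (?A\<^sup>T *\<^sub>v x) = x" if "x \<in> carrier_vec n" for x
    proof -
      have "C\<^sup>T *\<^sub>v (?A\<^sup>T *\<^sub>v x) = (C\<^sup>T * ?A\<^sup>T) *\<^sub>v x"
        using A C that by (intro assoc_mult_mat_vec[symmetric]) auto
      also have "C\<^sup>T * ?A\<^sup>T = 1\<^sub>m n" using transpose_mult[OF A C] AC by simp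
      finally show ?thesis using that by simp
    qed
    ultimately show "?w = S *\<^sub>v u" using w u by simp
  qed
  moreover have "det T = 1"
  proof -
    have "det ?A * det C = 1" using det_mult[OF A C] AC by simp
    moreover have "det D = prod_list (map snd fs)"
    proof -
      have "det D = prod_list (diag_mat D)"
        using D by (intro det_upper_triangular[of _ n]) (auto simp: D_def mat_diag_def)
      also have "diag_mat D = map snd fs"
        using len by (intro nth_equalityI) (auto simp: D_def mat_diag_def diag_mat_def)
      finally show ?thesis .
    qed
    moreover have "det T = det ?A * (det D * det C)"
      unfolding T_def using det_mult[OF A DC] det_mult[OF D C] by simp
    ultimately show ?thesis using fs by (simp add: frame_def algebra_simps)
  qed
  ultimately show ?thesis using T by blast
qed

section \<open>Frames built from strings of powers of \<open>X\<close>\<close>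

text \<open>The index \<open>c = m * i + a\<close> encodes the \<open>i\<close>-th power applied to
  the \<open>a\<close>-th generator. The factor \<open>(- 1) ^ i\<close> is the sign flip that a
  frame demands at each application of \<open>X\<close>.\<close>

definition strings :: "nat \<Rightarrow> nat \<Rightarrow> (nat \<Rightarrow> real vec) \<Rightarrow> (nat \<Rightarrow> real) \<Rightarrow> (real vec \<times> real) list" where
  "strings m d vs sg =
     map (\<lambda>c. (P (c div m) (vs (c mod m)), sg (c mod m) * (- 1) ^ (c div m))) [0..<m * d]"

lemma mem_strings:
  assumes "0 < m"
  shows "(u, s) \<in> set (strings m d vs sg) \<longleftrightarrow>
    (\<exists>i<d. \<exists>a<m. u = P i (vs a) \<and> s = sg a * (- 1) ^ i)"
proof
  assume "(u, s) \<in> set (strings m d vs sg)"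
  then obtain c where c: "c < m * d" "u = P (c div m) (vs (c mod m))"
    "s = sg (c mod m) * (- 1) ^ (c div m)" by (auto simp: strings_def)
  then have "c div m < d" "c mod m < m" using assms by (auto simp: less_mult_imp_div_less mult.commute)
  then show "\<exists>i<d. \<exists>a<m. u = P i (vs a) \<and> s = sg a * (- 1) ^ i" using c by blast
next
  assume "\<exists>i<d. \<exists>a<m. u = P i (vs a) \<and> s = sg a * (- 1) ^ i"
  then obtain i a where ia: "i < d" "a < m" "u = P i (vs a)" "s = sg a * (- 1) ^ i" by blast
  have "m * i + a < m * Suc i" using ia by simp
  also have "\<dots> \<le> m * d" using ia by (intro mult_le_mono2) simp
  finally have "m * i + a < m * d" .
  moreover have "(m * i + a) div m = i" "(m * i + a) mod m = a" using ia by simp_all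
  ultimately show "(u, s) \<in> set (strings m d vs sg)"
    unfolding strings_def using ia by (auto intro!: image_eqI[of _ _ "m * i + a"])
qed

lemma P_vanish:
  assumes "P d v = 0\<^sub>v n" "d \<le> k"
  shows "P k v = 0\<^sub>v n"
  using P_add[of "k - d" d v] assms by simp

text \<open>Ordering the vectors by the power of \<open>X\<close> first makes the Gram matrix antitriangular.\<close>

lemma frame_strings:
  assumes m: "0 < m"
    and vs: "\<And>a. a < m \<Longrightarrow> vs a \<in> carrier_vec n"
    and van: "\<And>a. a < m \<Longrightarrow> P d (vs a) = 0\<^sub>v n"
    and sg: "\<And>a. a < m \<Longrightarrow> sg a * sg a = 1"
    and par: "\<And>a b k. a < m \<Longrightarrow> b < m \<Longrightarrow> B (vs a) (P k (vs b)) \<noteq> 0 \<Longrightarrow> sg a = sg b * (- 1) ^ k"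
    and low: "\<And>a b. a < m \<Longrightarrow> b < m \<Longrightarrow> m \<le> a + b \<Longrightarrow> B (vs a) (P (d - 1) (vs b)) = 0"
    and diag: "\<And>a b. a + b + 1 = m \<Longrightarrow> B (vs a) (P (d - 1) (vs b)) \<noteq> 0"
    and prod: "prod_list (map snd (strings m d vs sg)) = 1"
  shows "frame (strings m d vs sg)"
proof (rule frameI)
  have inner: "B (P i (vs a)) (P j (vs b)) = (- 1) ^ i * B (vs a) (P (i + j) (vs b))"
    if "a < m" "b < m" for i j a b
    using B_P_left[of "vs a" "P j (vs b)" i] vs that by (simp add: P_add)
  have sq: "(- 1 :: real) ^ i * (- 1) ^ i = 1" for i by (simp flip: power_mult_distrib)
  show "u \<in> carrier_vec n \<and> s * s = 1 \<and>
      (X *\<^sub>v u = 0\<^sub>v n \<or> (X *\<^sub>v u, - s) \<in> set (strings m d vs sg))"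
    if us: "(u, s) \<in> set (strings m d vs sg)" for u s
  proof -
    from us obtain i a where ia: "i < d" "a < m" "u = P i (vs a)" "s = sg a * (- 1) ^ i"
      unfolding mem_strings[OF m] by blast
    have "s * s = (sg a * sg a) * ((- 1) ^ i * (- 1) ^ i)" using ia by (simp only: mult_ac)
    then have "s * s = 1" using sg ia sq by simp
    moreover have "X *\<^sub>v u = 0\<^sub>v n \<or> (X *\<^sub>v u, - s) \<in> set (strings m d vs sg)"
    proof (cases "Suc i < d")
      case True
      have "X *\<^sub>v u = P (Suc i) (vs a)" "- s = sg a * (- 1) ^ Suc i" using ia by (simp_all add: P_Suc)
      then show ?thesis unfolding mem_strings[OF m] using True ia by blast
    next
      case False
      then have "Suc i = d" using ia by simp
      then show ?thesis using van ia by (auto simp: P_Suc)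
    qed
    ultimately show ?thesis using vs ia by simp
  qed
  show "s = t" if us: "(u, s) \<in> set (strings m d vs sg)" and vt: "(v, t) \<in> set (strings m d vs sg)"
    and nz: "B u v \<noteq> 0" for u s v t
  proof -
    from us obtain i a where ia: "a < m" "u = P i (vs a)" "s = sg a * (- 1) ^ i"
      unfolding mem_strings[OF m] by blast
    from vt obtain j b where jb: "b < m" "v = P j (vs b)" "t = sg b * (- 1) ^ j"
      unfolding mem_strings[OF m] by blast
    \<comment> \<open>Moving \<open>P i\<close> across the form turns the pairing into one between
      \<open>vs a\<close> and \<open>P (i + j) (vs b)\<close>, to which the parity hypothesis
      applies.\<close>
    have "sg a = sg b * (- 1) ^ (i + j)" using par nz ia jb inner by auto
    then have "s = t * ((- 1) ^ i * (- 1) ^ i)"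
      unfolding ia jb by (simp only: power_add mult_ac)
    then show ?thesis using sq by simp
  qed
  let ?k = "m * d"
  have len: "length (strings m d vs sg) = ?k" by (simp add: strings_def)
  have entry: "gram (strings m d vs sg) $$ (c, c') =
      (- 1) ^ (c div m) * B (vs (c mod m)) (P (c div m + c' div m) (vs (c' mod m)))"
    if "c < ?k" "c' < ?k" for c c'
    using that m by (simp add: gram_def len) (simp add: strings_def inner)
  show "det (gram (strings m d vs sg)) \<noteq> 0"
  proof (rule det_antitriangular_nonzero)
    show "gram (strings m d vs sg) \<in> carrier_mat ?k ?k" using gram_carrier len by metis
    have split: "c + c' = m * (c div m + c' div m) + (c mod m + c' mod m)" for c c'
      using mult_div_mod_eq[of m c] mult_div_mod_eq[of m c'] by (simp add: distrib_left)
    have mods: "c mod m < m" for c using m by simp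
    show "gram (strings m d vs sg) $$ (c, c') = 0" if c: "c < ?k" "c' < ?k" "?k \<le> c + c'" for c c'
    proof -
      let ?i = "c div m + c' div m" and ?a = "c mod m + c' mod m"
      \<comment> \<open>Below the antidiagonal \<open>m * ?i + ?a\<close> is at least
        \<open>m * d\<close>, while \<open>?a < 2 * m\<close>. Hence either the total power reaches
        \<open>d\<close> and kills the generator, or it is exactly \<open>d - 1\<close> and the
        remainders add up to at least \<open>m\<close>.\<close>
      consider "d \<le> ?i" | "?i = d - 1" "m \<le> ?a"
      proof (cases "d \<le> ?i")
        case False
        then obtain e where e: "d = ?i + Suc e" using less_imp_add_positive[of ?i d]
          by (metis Suc_pred not_le)
        have "m * ?i + m * Suc e \<le> m * ?i + ?a"
          using c(3) split[of c c'] e by (metis distrib_left)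
        then have le: "m * Suc e \<le> ?a" by simp
        moreover have "?a < 2 * m" using mods[of c] mods[of c'] by linarith
        ultimately have "m * Suc e < m * 2" by linarith
        then have "e = 0" by simp
        then show ?thesis using le e that(2) by simp
      qed (use that in blast)
      then have "B (vs (c mod m)) (P ?i (vs (c' mod m))) = 0"
      proof cases
        case 1
        then show ?thesis using P_vanish[OF van[OF mods] 1] vs mods by simp
      next
        case 2
        then show ?thesis using low mods by simp
      qed
      then show ?thesis using entry c by simp
    qed
    show "gram (strings m d vs sg) $$ (c, c') \<noteq> 0" if c: "c + c' + 1 = ?k" for c c'
    proof -
      let ?i = "c div m + c' div m" and ?a = "c mod m + c' mod m"
      \<comment> \<open>On the antidiagonal \<open>?a + 1\<close> is a positive multiple of
        \<open>m\<close> smaller than \<open>2 * m\<close>, hence equal to \<open>m\<close>; this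
        leaves total power \<open>d - 1\<close>.\<close>
      have eq: "m * ?i + (?a + 1) = m * d" using c split[of c c'] by simp
      have "m * ?i < m * d" using eq by linarith
      then have "?i < d" by simp
      then obtain e where e: "d = ?i + Suc e" using less_imp_Suc_add by force
      have "m * d = m * ?i + m * Suc e" unfolding e by (simp add: distrib_left)
      then have a: "?a + 1 = m * Suc e" using eq by simp
      have "?a + 1 < 2 * m" using mods[of c] mods[of c'] by linarith
      then have "m * Suc e < m * 2" using a by linarith
      then have "e = 0" by simp
      then have "?a + 1 = m" "?i = d - 1" using a e by auto
      then have "B (vs (c mod m)) (P ?i (vs (c' mod m))) \<noteq> 0" using diag by simp
      then show ?thesis using entry[of c c'] c by simp
    qed
  qed
  show "prod_list (map snd (strings m d vs sg)) = 1" by (rule prod)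
qed

section \<open>Extending a frame inside its orthogonal complement\<close>

text \<open>Stability under \<open>X\<close> comes from skewness: \<open>B u (X *\<^sub>v x)\<close>
  equals \<open>- B (X *\<^sub>v u) x\<close>, and \<open>X *\<^sub>v u\<close> is zero or again a
  frame vector.\<close>

lemma perp_closed:
  assumes fs: "frame fs" and y: "y \<in> perp fs"
  shows "P k y \<in> perp fs" "c \<cdot>\<^sub>v y \<in> perp fs" "z \<in> perp fs \<Longrightarrow> y + z \<in> perp fs"
proof -
  have Xp: "X *\<^sub>v x \<in> perp fs" if x: "x \<in> perp fs" for x
  proof (rule perpI)
    show "X *\<^sub>v x \<in> carrier_vec n" using perpD(1)[OF x] by simp
    fix u s assume us: "(u, s) \<in> set fs"
    have "B (X *\<^sub>v u) x = 0"
      using frameD(3)[OF fs us] perpD(1)[OF x] perpD(2)[OF x] by auto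
    then show "B u (X *\<^sub>v x) = 0"
      using B_skew[OF frameD(1)[OF fs us] perpD(1)[OF x]] by simp
  qed
  show "P k y \<in> perp fs" by (induction k) (use y Xp in \<open>auto simp: P_Suc\<close>)
  show "c \<cdot>\<^sub>v y \<in> perp fs"
    by (rule perpI) (use perpD[OF y] frameD(1)[OF fs] in \<open>auto simp: B_smult\<close>)
  show "y + z \<in> perp fs" if "z \<in> perp fs"
    by (rule perpI) (use perpD[OF y] perpD[OF that] frameD(1)[OF fs] in \<open>auto simp: B_add\<close>)
qed

text \<open>Adding a multiple of \<open>P (r + 1) w\<close> to \<open>w\<close> clears the next lower pairing with \<open>v\<close>.\<close>

lemma normalize_pairing:
  assumes fs: "frame fs" and v: "v \<in> perp fs" and w: "w \<in> perp fs"
    and van: "\<And>y. y \<in> perp fs \<Longrightarrow> P d y = 0\<^sub>v n" and top: "B v (P (d - 1) w) \<noteq> 0"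
  shows "\<exists>w'\<in>perp fs. B v (P (d - 1) w') \<noteq> 0 \<and> (\<forall>k<d - 1. d - 1 \<le> k + r \<longrightarrow> B v (P k w') = 0)"
proof (induction r)
  case 0
  show ?case using w top by (intro bexI[of _ w]) auto
next
  case (Suc r)
  then obtain x where x: "x \<in> perp fs" "B v (P (d - 1) x) \<noteq> 0"
    "\<And>k. k < d - 1 \<Longrightarrow> d - 1 \<le> k + r \<Longrightarrow> B v (P k x) = 0" by blast
  have vc: "v \<in> carrier_vec n" and xc: "x \<in> carrier_vec n"
    using perpD(1)[OF v] perpD(1)[OF x(1)] .
  have zero: "B v (P k x) = 0" if "d \<le> k" for k
    using P_vanish[OF van[OF x(1)] that] vc by simp
  \<comment> \<open>This ratio cancels the pairing at exponent \<open>d - 1 - Suc r\<close>. At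
    larger exponents the correction involves powers of at least \<open>d\<close> and vanishes. If
    \<open>Suc r\<close> exceeds \<open>d - 1\<close> the subtraction truncates, but then no pairing
    is left to clear.\<close>
  define c where "c = - B v (P (d - 1 - Suc r) x) / B v (P (d - 1) x)"
  define x' where "x' = x + c \<cdot>\<^sub>v P (Suc r) x"
  have x': "x' \<in> perp fs" unfolding x'_def using perp_closed[OF fs] x(1) by blast
  have eq: "B v (P k x') = B v (P k x) + c * B v (P (k + Suc r) x)" for k
    unfolding x'_def using vc xc P_add[of k "Suc r" x]
    by (simp add: P_plus P_smult B_add B_smult)
  have "B v (P (d - 1) x') \<noteq> 0" using eq[of "d - 1"] zero[of "d - 1 + Suc r"] x(2) by simp
  moreover have "B v (P k x') = 0" if k: "k < d - 1" "d - 1 \<le> k + Suc r" for k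
  proof (cases "d - 1 \<le> k + r")
    case True
    then show ?thesis using eq[of k] x(3)[OF k(1)] zero[of "k + Suc r"] by simp
  next
    case False
    then have "k + Suc r = d - 1" "k = d - 1 - Suc r" using k by auto
    then have "B v (P k x') = B v (P k x) + c * B v (P (d - 1) x)"
      "c = - B v (P k x) / B v (P (d - 1) x)"
      using eq[of k] by (simp_all only: c_def)
    then show ?thesis using x(2) by simp
  qed
  ultimately show ?case using x' by blast
qed

lemma prod_list_signs_single:
  fixes f :: "nat \<Rightarrow> real"
  shows "prod_list (map (\<lambda>c. s * f c) [0..<d]) = s ^ d * prod_list (map f [0..<d])"
  by (induction d) auto

text \<open>At each power the two strings carry opposite signs, so every level contributes a factor
  \<open>- 1\<close>.\<close>

lemma prod_list_signs_pair:
  "prod_list (map (\<lambda>c. (if c mod 2 = 0 then 1 else - 1) * (- 1 :: real) ^ (c div 2)) [0..<2 * d])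
    = (- 1) ^ d"
proof (induction d)
  case (Suc d)
  have "[0..<2 * Suc d] = [0..<2 * d] @ [2 * d, Suc (2 * d)]" by simp
  then show ?case using Suc by (simp flip: power_mult_distrib)
qed simp

lemma frame_extend:
  assumes fs: "frame fs" and nontriv: "\<not> perp fs \<subseteq> {0\<^sub>v n}"
  obtains gs where "frame gs" "gs \<noteq> []" "\<And>g s. (g, s) \<in> set gs \<Longrightarrow> g \<in> perp fs"
proof -
  define d where "d = (LEAST d. \<forall>y\<in>perp fs. P d y = 0\<^sub>v n)"
  have "\<exists>d. \<forall>y\<in>perp fs. P d y = 0\<^sub>v n" using P_nilpotent perpD(1) by blast
  from LeastI_ex[OF this] have van: "\<And>y. y \<in> perp fs \<Longrightarrow> P d y = 0\<^sub>v n"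
    unfolding d_def by blast
  have d: "0 < d"
  proof (rule ccontr)
    assume "\<not> 0 < d"
    then show False using van nontriv by auto
  qed
  \<comment> \<open>Minimality of \<open>d\<close> provides a vector with nonzero top power, and
    nondegeneracy of the complement provides a partner for it.\<close>
  then have "\<not> (\<forall>y\<in>perp fs. P (d - 1) y = 0\<^sub>v n)"
    using not_less_Least[of "d - 1" "\<lambda>d. \<forall>y\<in>perp fs. P d y = 0\<^sub>v n"] unfolding d_def by simp
  then obtain y where y: "y \<in> perp fs" "P (d - 1) y \<noteq> 0\<^sub>v n" by blast
  obtain z where z: "z \<in> perp fs" "B (P (d - 1) y) z \<noteq> 0"
    using perp_nondeg[OF fs perp_closed(1)[OF fs y(1)] y(2)] .
  have yc: "y \<in> carrier_vec n" and zc: "z \<in> carrier_vec n"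
    using perpD(1)[OF y(1)] perpD(1)[OF z(1)] .
  have yz: "B y (P (d - 1) z) \<noteq> 0" using z(2) B_P_left[OF yc zc, of "d - 1"] by auto
  have strings_in: "g \<in> perp fs"
    if "0 < m" "\<And>a. a < m \<Longrightarrow> vs a \<in> perp fs" "(g, s) \<in> set (strings m d vs sg)" for m vs sg g s
    using that perp_closed(1)[OF fs] unfolding mem_strings[OF that(1)] by blast
  have odd_zero: "B v (P k v) = 0" if "v \<in> carrier_vec n" "odd k" for v k
    using B_P_swap[OF that(1) that(1), of k] that(2) by simp
  show thesis
  proof (cases "odd d")
    case True
    then have ev: "even (d - 1)" by simp
    have "\<exists>v\<in>perp fs. B v (P (d - 1) v) \<noteq> 0"
    proof (rule ccontr)
      assume "\<not> ?thesis"
      then have iso: "B v (P (d - 1) v) = 0" if "v \<in> perp fs" for v using that by blast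
      \<comment> \<open>Polarization: for even \<open>d - 1\<close> the form
        \<open>B v (P (d - 1) w)\<close> is symmetric, so if it vanished on the diagonal it would
        vanish on \<open>y, z\<close>.\<close>
      have "B (y + z) (P (d - 1) (y + z)) = B y (P (d - 1) y) + B z (P (d - 1) z) +
          (B y (P (d - 1) z) + B z (P (d - 1) y))"
        using yc zc by (simp add: P_plus B_add)
      also have "B z (P (d - 1) y) = B y (P (d - 1) z)" using B_P_swap[OF yc zc] ev by simp
      finally show False using iso[OF y(1)] iso[OF z(1)] iso[OF perp_closed(3)[OF fs y(1) z(1)]] yz
        by simp
    qed
    then obtain v where v: "v \<in> perp fs" "B v (P (d - 1) v) \<noteq> 0" by blast
    have vc: "v \<in> carrier_vec n" using perpD(1)[OF v(1)] .
    \<comment> \<open>With initial sign \<open>e\<close> the product of all signs is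
      \<open>e ^ d * e\<close>; as \<open>d + 1\<close> is even and \<open>e * e = 1\<close>, this
      equals \<open>1\<close>.\<close>
    define e :: real where "e = prod_list (map (\<lambda>c. (- 1) ^ c) [0..<d])"
    have ee: "e * e = 1"
    proof -
      have "prod_list (map (\<lambda>c. (- 1) ^ c) [0..<d]) * prod_list (map (\<lambda>c. (- 1) ^ c) [0..<d]) = (1 :: real)" for d
        by (induction d) (simp_all add: algebra_simps flip: power_mult_distrib)
      then show ?thesis unfolding e_def .
    qed
    have "e ^ d * e = 1"
      using True ee by (elim oddE) (simp add: power_mult power2_eq_square)
    then have "prod_list (map snd (strings 1 d (\<lambda>_. v) (\<lambda>_. e))) = 1"
      using prod_list_signs_single[of e "\<lambda>c. (- 1) ^ c" d]
      by (simp add: strings_def comp_def e_def[symmetric])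
    moreover have "e = e * (- 1) ^ k" if "B v (P k v) \<noteq> 0" for k
      using odd_zero[OF vc, of k] that by (cases "even k") auto
    ultimately have F: "frame (strings 1 d (\<lambda>_. v) (\<lambda>_. e))"
      using vc van[OF v(1)] ee v(2) by (intro frame_strings) auto
    show ?thesis
    proof (rule that[OF F])
      show "strings 1 d (\<lambda>_. v) (\<lambda>_. e) \<noteq> []" using d by (simp add: strings_def)
      show "g \<in> perp fs" if "(g, s) \<in> set (strings 1 d (\<lambda>_. v) (\<lambda>_. e))" for g s
        by (rule strings_in[OF _ _ that]) (use v in auto)
    qed
  next
    case False
    then have od: "odd (d - 1)" and ev: "even d" using d by auto
    \<comment> \<open>Taking \<open>r = d - 1\<close> in the normalization covers all exponents
      below \<open>d - 1\<close>, so \<open>y\<close> and \<open>w\<close> pair at the top power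
      only.\<close>
    obtain w where w: "w \<in> perp fs" "B y (P (d - 1) w) \<noteq> 0"
      "\<And>k. k < d - 1 \<Longrightarrow> B y (P k w) = 0"
      using normalize_pairing[OF fs y(1) z(1) van yz, of "d - 1"] by auto
    have wc: "w \<in> carrier_vec n" using perpD(1)[OF w(1)] .
    have yw: "k = d - 1" if "B y (P k w) \<noteq> 0" for k
    proof -
      have "\<not> k < d - 1" using w(3) that by blast
      moreover have "\<not> d \<le> k" using P_vanish[OF van[OF w(1)], of k] that yc by auto
      ultimately show ?thesis by simp
    qed
    have wy: "k = d - 1" if "B w (P k y) \<noteq> 0" for k
      using yw[of k] B_P_swap[OF yc wc, of k] that by auto
    define vs where "vs a = (if a = 0 then y else w)" for a :: nat
    \<comment> \<open>The two strings meet only at the odd exponent \<open>d - 1\<close>, which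
      forces opposite initial signs. Within one string only even exponents can pair
      nontrivially.\<close>
    define sg :: "nat \<Rightarrow> real" where "sg a = (if a = 0 then 1 else - 1)" for a
    have vsp: "vs a \<in> perp fs" for a using y(1) w(1) by (simp add: vs_def)
    have "prod_list (map snd (strings 2 d vs sg)) = 1"
      using prod_list_signs_pair[of d] ev by (simp add: strings_def comp_def sg_def)
    moreover have "sg a = sg b * (- 1) ^ k" if "B (vs a) (P k (vs b)) \<noteq> 0" for a b k
      using that odd_zero[OF yc, of k] odd_zero[OF wc, of k] yw[of k] wy[of k] od
      by (cases "even k") (auto simp: vs_def sg_def split: if_splits)
    moreover have "B (vs a) (P (d - 1) (vs b)) = 0" if "a < 2" "b < 2" "2 \<le> a + b" for a b
      using that odd_zero[OF wc od] by (simp add: vs_def)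
    moreover have "B (vs a) (P (d - 1) (vs b)) \<noteq> 0" if "a + b + 1 = 2" for a b
    proof -
      have "B w (P (d - 1) y) \<noteq> 0" using B_P_swap[OF yc wc, of "d - 1"] w(2) by simp
      moreover have "a = 0 \<and> b = 1 \<or> a = 1 \<and> b = 0" using that by auto
      ultimately show ?thesis using w(2) by (auto simp: vs_def)
    qed
    moreover have "sg a * sg a = 1" for a by (simp add: sg_def)
    ultimately have F: "frame (strings 2 d vs sg)"
      using perpD(1)[OF vsp] van[OF vsp] by (intro frame_strings) auto
    show ?thesis
    proof (rule that[OF F])
      show "strings 2 d vs sg \<noteq> []" using d by (simp add: strings_def)
      show "g \<in> perp fs" if "(g, s) \<in> set (strings 2 d vs sg)" for g s
        by (rule strings_in[OF _ _ that]) (use vsp in auto)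
    qed
  qed
qed

section \<open>Exhausting the space, and the passage to \<open>SO p q\<close>\<close>

text \<open>Starting from the empty frame, strings are appended until the complement is trivial; the
  induction is on the number of vectors still missing.\<close>

lemma exists_reversing_involution:
  "\<exists>T\<in>carrier_mat n n. T * T = 1\<^sub>m n \<and> T * X = - (X * T) \<and> T\<^sup>T * S * T = S \<and> det T = 1"
proof -
  have "\<exists>T\<in>carrier_mat n n. T * T = 1\<^sub>m n \<and> T * X = - (X * T) \<and> T\<^sup>T * S * T = S \<and> det T = 1"
    if "frame fs" for fs
    using that
  proof (induction "n - length fs" arbitrary: fs rule: less_induct)
    case less
    show ?case
    proof (cases "perp fs \<subseteq> {0\<^sub>v n}")
      case True
      then show ?thesis using frame_complete less by blast
    next
      case False
      obtain gs where gs: "frame gs" "gs \<noteq> []" "\<And>g s. (g, s) \<in> set gs \<Longrightarrow> g \<in> perp fs"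
        by (rule frame_extend[OF less(2) False]) (rule that)
      have fg: "frame (fs @ gs)" using frame_append[OF less(2) gs(1,3)] .
      \<comment> \<open>The longer list is still a frame, so its length is at most \<open>n\<close>
        and the truncated difference strictly drops.\<close>
      have "n - length (fs @ gs) < n - length fs"
        using frame_length[OF fg] gs(2) by (cases gs) auto
      from less(1)[OF this fg] show ?thesis .
    qed
  qed
  then show ?thesis using frame_Nil .
qed

end

theorem theorem5p6:
  fixes p q :: nat and X :: "real mat"
  assumes "p > 0" and "q > 0"
    and "X \<in> so_alg p q" and "nilpotent_mat X"
  shows "strongly_Ad_real (SO p q) X"
proof -
  let ?n = "p + q" and ?J = "I_mat p q"
  have X: "X \<in> carrier_mat ?n ?n" and skew: "X\<^sup>T * ?J + ?J * X = 0\<^sub>m ?n ?n"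
    using assms(3) by (auto simp: so_alg_def sl_mat_def)
  have "det ?J * det ?J = 1"
    using det_mult[OF I_mat_carrier I_mat_carrier, of p q] I_mat_square[of p q] by simp
  then have "det ?J \<noteq> 0" by auto
  moreover have "?J\<^sup>T = ?J"
    by (rule eq_matI) (auto simp: I_mat_index carrier_matD[OF I_mat_carrier])
  moreover have "\<exists>k. X ^\<^sub>m k = 0\<^sub>m ?n ?n"
    using assms(4) X by (auto simp: nilpotent_mat_def)
  ultimately interpret skew_nilpotent ?n ?J X
    using X skew by unfold_locales auto
  obtain T where T: "T \<in> carrier_mat ?n ?n" "T * T = 1\<^sub>m ?n" "T * X = - (X * T)"
    "T\<^sup>T * ?J * T = ?J" "det T = 1"
    using exists_reversing_involution by blast
  have mem: "T \<in> carrier (SO p q)" using T by (simp add: SO_def SL_mat_def)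
  have sq: "T \<otimes>\<^bsub>SO p q\<^esub> T = \<one>\<^bsub>SO p q\<^esub>" using T(2) by (simp add: SO_def)
  \<comment> \<open>Since \<open>T\<close> squares to the identity it is its own inverse in the
    group, so \<open>Ad\<close> becomes \<open>T * X * T\<close>.\<close>
  have "inv\<^bsub>SO p q\<^esub> T = T" using group.inv_equality[OF group_SO sq mem mem] .
  moreover have "T * X * T = - X"
  proof -
    have "T * X * T = - (X * T * T)" using T(1,3) X by simp
    also have "X * T * T = X" using T(1,2) X by (simp add: assoc_mult_mat[of _ ?n ?n _ ?n _ ?n])
    finally show ?thesis .
  qed
  ultimately show ?thesis
    unfolding strongly_Ad_real_def Ad_def using mem sq by (intro bexI[of _ T]) simp_all
qed

end
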